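(* The space $L^2[-1,1]$ of square integrable functions on $[-1,1]$, with inner product $\langle f,g\rangle=\int fg\,d\mu$, is a Hilbert space.
   Context: $\mu$ is Lebesgue measure on $[-1,1]$. A measurable function $f:[-1,1]\to\mathbb{R}$ is square integrable if $f^2$ is (Lebesgue) integrable; $L^2[-1,1]$ is the real vector space of square integrable functions, where two functions that are equal almost everywhere are regarded as the same. The norm is $\|f\|=\big(\int f^2\,d\mu\big)^{1/2}$. A Hilbert space is a real inner product space that is complete, i.e. in which every Cauchy sequence (with respect to the norm $\|v\|=\sqrt{\langle v,v\rangle}$) converges. *)

theory Defs
  imports "HOL-Analysis.Analysis"
begin

locale real_inner_product =
  fixes ip :: "'a::real_vector \<Rightarrow> 'a \<Rightarrow> real"
  assumes commute: "ip x y = ip y x"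
    and add_left: "ip (x + y) z = ip x z + ip y z"
    and scaleR_left: "ip (c *\<^sub>R x) y = c * ip x y"
    and nonneg: "0 \<le> ip x x"
    and eq_zero: "ip x x = 0 \<Longrightarrow> x = 0"
begin

definition ip_norm :: "'a \<Rightarrow> real"
  where "ip_norm v = sqrt (ip v v)"

definition ip_Cauchy :: "(nat \<Rightarrow> 'a) \<Rightarrow> bool"
  where "ip_Cauchy X \<longleftrightarrow>
    (\<forall>e>0. \<exists>N. \<forall>m\<ge>N. \<forall>n\<ge>N. ip_norm (X m - X n) < e)"

definition ip_converges_to :: "(nat \<Rightarrow> 'a) \<Rightarrow> 'a \<Rightarrow> bool"
  where "ip_converges_to X l \<longleftrightarrow> (\<lambda>n. ip_norm (X n - l)) \<longlonglongrightarrow> 0"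

end

locale real_hilbert_space = real_inner_product +
  assumes complete: "ip_Cauchy X \<Longrightarrow> \<exists>l. ip_converges_to X l"

text \<open>
  Functions on \<open>[-1,1]\<close> are represented by functions on all of \<open>\<real>\<close>. Every notion below looks
  only at the restriction to \<open>[-1,1]\<close>, because the underlying measure is Lebesgue measure on
  that interval; values outside it are irrelevant and are identified in the quotient \<open>L2\<close>.
\<close>

abbreviation mu :: "real measure"
  where "mu \<equiv> lebesgue_on {-1..1}"

definition square_integrable :: "(real \<Rightarrow> real) \<Rightarrow> bool"
  where "square_integrable f \<longleftrightarrow>
    f \<in> borel_measurable mu \<and> integrable mu (\<lambda>x. (f x)\<^sup>2)"

lemma square_integrable_mult:
  assumes "square_integrable f" "square_integrable g"
  shows "integrable mu (\<lambda>x. f x * g x)"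
proof (rule Bochner_Integration.integrable_bound)
  show "integrable mu (\<lambda>x. (f x)\<^sup>2 + (g x)\<^sup>2)"
    using assms by (simp add: square_integrable_def)
  show "(\<lambda>x. f x * g x) \<in> borel_measurable mu"
    using assms by (auto simp: square_integrable_def)
  have "\<bar>a * b\<bar> \<le> a\<^sup>2 + b\<^sup>2" for a b :: real
  proof -
    have "2 * \<bar>a * b\<bar> \<le> a\<^sup>2 + b\<^sup>2"
      using sum_squares_bound[of "\<bar>a\<bar>" "\<bar>b\<bar>"] by (simp add: abs_mult)
    then show ?thesis by linarith
  qed
  then show "AE x in mu. norm (f x * g x) \<le> norm ((f x)\<^sup>2 + (g x)\<^sup>2)"
    by simp
qed

lemma square_integrable_zero: "square_integrable (\<lambda>x. 0)"
  by (simp add: square_integrable_def)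

lemma square_integrable_add:
  assumes "square_integrable f" "square_integrable g"
  shows "square_integrable (\<lambda>x. f x + g x)"
  using assms square_integrable_mult[OF assms]
  by (auto simp: square_integrable_def power2_sum mult.assoc)

lemma square_integrable_scale:
  assumes "square_integrable f"
  shows "square_integrable (\<lambda>x. c * f x)"
  using assms by (auto simp: square_integrable_def power_mult_distrib)

lemma square_integrable_uminus:
  assumes "square_integrable f"
  shows "square_integrable (\<lambda>x. - f x)"
  using assms by (simp add: square_integrable_def)

lemma square_integrable_diff:
  assumes "square_integrable f" "square_integrable g"
  shows "square_integrable (\<lambda>x. f x - g x)"
  using square_integrable_add[OF assms(1) square_integrable_uminus[OF assms(2)]] by simp

definition L2_rel :: "(real \<Rightarrow> real) \<Rightarrow> (real \<Rightarrow> real) \<Rightarrow> bool"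
  where "L2_rel f g \<longleftrightarrow>
    square_integrable f \<and> square_integrable g \<and> (AE x in mu. f x = g x)"

quotient_type L2 = "real \<Rightarrow> real" / partial: L2_rel
proof (rule part_equivpI)
  show "\<exists>f. L2_rel f f"
    using square_integrable_zero by (auto simp: L2_rel_def)
  show "symp L2_rel"
    by (auto simp: symp_def L2_rel_def elim: eventually_mono)
  show "transp L2_rel"
    by (auto simp: transp_def L2_rel_def elim: eventually_elim2)
qed

instantiation L2 :: real_vector
begin

lift_definition zero_L2 :: L2 is "\<lambda>x. 0"
  by (simp add: L2_rel_def square_integrable_zero)

lift_definition plus_L2 :: "L2 \<Rightarrow> L2 \<Rightarrow> L2" is "\<lambda>f g x. f x + g x"
  by (auto simp: L2_rel_def square_integrable_add elim: eventually_elim2)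

lift_definition uminus_L2 :: "L2 \<Rightarrow> L2" is "\<lambda>f x. - f x"
  by (auto simp: L2_rel_def square_integrable_uminus)

lift_definition minus_L2 :: "L2 \<Rightarrow> L2 \<Rightarrow> L2" is "\<lambda>f g x. f x - g x"
  by (auto simp: L2_rel_def square_integrable_diff elim: eventually_elim2)

lift_definition scaleR_L2 :: "real \<Rightarrow> L2 \<Rightarrow> L2" is "\<lambda>c f x. c * f x"
  by (auto simp: L2_rel_def square_integrable_scale elim: eventually_mono)

instance
  by standard
    (transfer, auto simp: L2_rel_def algebra_simps
      intro!: square_integrable_zero square_integrable_add square_integrable_diff
        square_integrable_uminus square_integrable_scale)+

end

lift_definition L2_inner :: "L2 \<Rightarrow> L2 \<Rightarrow> real" is "\<lambda>f g. \<integral>x. f x * g x \<partial>mu"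
proof -
  fix f f' g g' :: "real \<Rightarrow> real"
  assume f: "L2_rel f f'" and g: "L2_rel g g'"
  have "AE x in mu. f x * g x = f' x * g' x"
    using f g by (auto simp: L2_rel_def elim: eventually_elim2)
  with f g show "(\<integral>x. f x * g x \<partial>mu) = (\<integral>x. f' x * g' x \<partial>mu)"
    by (intro integral_cong_AE) (auto simp: L2_rel_def square_integrable_def)
qed

end

theory Submission
  imports Defs
begin

text \<open>
  The inner product axioms are pointwise identities under the integral sign; definiteness holds
  because a nonnegative function with integral zero vanishes almost everywhere, which is equality
  to zero in the quotient \<open>L2\<close>.

  Completeness is the Riesz--Fischer theorem, which holds over any measure space
  (\<open>Riesz_Fischer\<close>). From a Cauchy sequence \<open>f\<close> one extracts a subsequence \<open>f \<circ> r\<close> whose consecutive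
  differences \<open>d k\<close> satisfy \<open>\<integral>(d k)\<^sup>2 \<le> 4\<^sup>-\<^sup>k\<close>. Then \<open>\<Sum>k. 2\<^sup>k (d k)\<^sup>2\<close> has a finite integral, hence
  converges almost everywhere, and since \<open>\<bar>d k\<bar> \<le> 2\<^sup>k (d k)\<^sup>2 + 2\<^sup>-\<^sup>k\<close> the subsequence converges
  almost everywhere to some \<open>g\<close>. Fatou's lemma, applied along the subsequence to
  \<open>(f n - f (r k))\<^sup>2\<close>, passes the Cauchy estimate to \<open>\<integral>(f n - g)\<^sup>2\<close>; this gives both the square
  integrability of \<open>g\<close> and the convergence of the whole sequence.
\<close>

section \<open>The Riesz--Fischer theorem\<close>

lemma integrable_square_diff:
  fixes f g :: "'a \<Rightarrow> real"
  assumes "f \<in> borel_measurable M" "g \<in> borel_measurable M"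
    and "integrable M (\<lambda>x. (f x)\<^sup>2)" "integrable M (\<lambda>x. (g x)\<^sup>2)"
  shows "integrable M (\<lambda>x. (f x - g x)\<^sup>2)"
proof (rule Bochner_Integration.integrable_bound)
  show "integrable M (\<lambda>x. 2 * (f x)\<^sup>2 + 2 * (g x)\<^sup>2)"
    using assms by simp
  show "(\<lambda>x. (f x - g x)\<^sup>2) \<in> borel_measurable M"
    using assms(1,2) by measurable
  have "(a - b)\<^sup>2 \<le> 2 * a\<^sup>2 + 2 * b\<^sup>2" for a b :: real
    using zero_le_power2[of "a + b"] by (simp add: power2_sum power2_diff)
  then show "AE x in M. norm ((f x - g x)\<^sup>2) \<le> norm (2 * (f x)\<^sup>2 + 2 * (g x)\<^sup>2)"
    by simp
qed

text \<open>
  By monotone convergence the integral of the sum is the sum of the integrals, so it is finite,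
  and a function with a finite integral is finite almost everywhere.
\<close>

lemma AE_summable_if_summable_integral:
  fixes h :: "nat \<Rightarrow> 'a \<Rightarrow> real"
  assumes int: "\<And>k. integrable M (h k)" and nonneg: "\<And>k x. 0 \<le> h k x"
    and sum: "summable (\<lambda>k. \<integral>x. h k x \<partial>M)"
  shows "AE x in M. summable (\<lambda>k. h k x)"
proof -
  have meas [measurable]: "h k \<in> borel_measurable M" for k
    using int by auto
  have "(\<integral>\<^sup>+x. (\<Sum>k. ennreal (h k x)) \<partial>M) = (\<Sum>k. \<integral>\<^sup>+x. ennreal (h k x) \<partial>M)"
    by (rule nn_integral_suminf) simp
  also have "\<dots> = (\<Sum>k. ennreal (\<integral>x. h k x \<partial>M))"
    by (simp add: nn_integral_eq_integral int nonneg)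
  also have "\<dots> = ennreal (\<Sum>k. \<integral>x. h k x \<partial>M)"
    by (rule suminf_ennreal2) (simp_all add: nonneg sum)
  finally have "(\<integral>\<^sup>+x. (\<Sum>k. ennreal (h k x)) \<partial>M) \<noteq> \<infinity>"
    by simp
  then have "AE x in M. (\<Sum>k. ennreal (h k x)) \<noteq> \<infinity>"
    by (intro nn_integral_PInf_AE) simp_all
  then show ?thesis
    by eventually_elim (auto intro: summable_suminf_not_top simp: nonneg)
qed

text \<open>
  The weight \<open>2\<^sup>k\<close> trades the square for the first power: \<open>\<bar>d\<bar> \<le> 2\<^sup>k d\<^sup>2\<close> when \<open>\<bar>d\<bar> \<ge> 2\<^sup>-\<^sup>k\<close>, and
  otherwise \<open>\<bar>d\<bar>\<close> is below the summable bound \<open>2\<^sup>-\<^sup>k\<close>. This replaces the usual appeal to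
  Minkowski's inequality.
\<close>

lemma AE_convergent_if_fast_L2_Cauchy:
  fixes f :: "nat \<Rightarrow> 'a \<Rightarrow> real"
  assumes int: "\<And>k. integrable M (\<lambda>x. (f (Suc k) x - f k x)\<^sup>2)"
    and bound: "\<And>k. (\<integral>x. (f (Suc k) x - f k x)\<^sup>2 \<partial>M) \<le> (1/4)^k"
  shows "AE x in M. convergent (\<lambda>k. f k x)"
proof -
  define h where "h k x = 2^k * (f (Suc k) x - f k x)\<^sup>2" for k x
  have "AE x in M. summable (\<lambda>k. h k x)"
  proof (rule AE_summable_if_summable_integral)
    show "integrable M (h k)" for k
      unfolding h_def using int by simp
    show "0 \<le> h k x" for k x
      by (simp add: h_def)
    show "summable (\<lambda>k. \<integral>x. h k x \<partial>M)"
    proof (rule summable_comparison_test')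
      show "summable (\<lambda>k. (1/2::real)^k)"
        by (simp add: summable_geometric)
      fix k :: nat
      have "(\<integral>x. h k x \<partial>M) \<le> 2^k * (1/4)^k"
        unfolding h_def using bound[of k] by simp
      also have "\<dots> = (1/2::real)^k"
        by (simp flip: power_mult_distrib)
      finally show "norm (\<integral>x. h k x \<partial>M) \<le> (1/2)^k"
        by (simp add: h_def)
    qed
  qed
  then show ?thesis
  proof eventually_elim
    fix x assume "summable (\<lambda>k. h k x)"
    then have bound_summable: "summable (\<lambda>k. h k x + (1/2)^k)"
      by (intro summable_add) (simp_all add: summable_geometric)
    have weight: "\<bar>d\<bar> \<le> 2^k * d\<^sup>2 + (1/2)^k" for d :: real and k :: nat
    proof (cases "\<bar>d\<bar> \<le> (1/2)^k")
      case False
      then have "1 \<le> 2^k * \<bar>d\<bar>"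
        by (simp add: field_simps power_one_over)
      then have "1 * \<bar>d\<bar> \<le> (2^k * \<bar>d\<bar>) * \<bar>d\<bar>"
        by (rule mult_right_mono) simp
      also have "\<dots> = 2^k * d\<^sup>2"
        by (simp add: power2_eq_square)
      finally show ?thesis
        by (simp add: add_increasing2)
    qed (simp add: add_increasing)
    have "summable (\<lambda>k. f (Suc k) x - f k x)"
    proof (rule summable_comparison_test'[OF bound_summable])
      show "norm (f (Suc k) x - f k x) \<le> h k x + (1/2)^k" for k
        unfolding h_def real_norm_def by (rule weight)
    qed
    then have "(\<lambda>n. \<Sum>k<n. f (Suc k) x - f k x) \<longlonglongrightarrow> (\<Sum>k. f (Suc k) x - f k x)"
      by (rule summable_LIMSEQ)
    then have "(\<lambda>n. (f n x - f 0 x) + f 0 x) \<longlonglongrightarrow> (\<Sum>k. f (Suc k) x - f k x) + f 0 x"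
      unfolding sum_lessThan_telescope[of "\<lambda>k. f k x"] by (intro tendsto_add tendsto_const)
    then show "convergent (\<lambda>k. f k x)"
      by (auto simp: convergent_def)
  qed
qed

text \<open>
  This is Fatou's lemma for \<open>(u - v k)\<^sup>2\<close>. Integrability of the limit has to be a conclusion,
  because it is what later puts the limit of a Cauchy sequence into the space.
\<close>

lemma L2_dist_limit_le:
  fixes u g :: "'a \<Rightarrow> real" and v :: "nat \<Rightarrow> 'a \<Rightarrow> real"
  assumes [measurable]: "u \<in> borel_measurable M" "g \<in> borel_measurable M"
      "\<And>k. v k \<in> borel_measurable M"
    and int: "\<And>k. integrable M (\<lambda>x. (u x - v k x)\<^sup>2)"
    and conv: "AE x in M. (\<lambda>k. v k x) \<longlonglongrightarrow> g x"
    and bound: "eventually (\<lambda>k. (\<integral>x. (u x - v k x)\<^sup>2 \<partial>M) \<le> e) sequentially"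
  shows "integrable M (\<lambda>x. (u x - g x)\<^sup>2)" "(\<integral>x. (u x - g x)\<^sup>2 \<partial>M) \<le> e"
proof -
  obtain k where "(\<integral>x. (u x - v k x)\<^sup>2 \<partial>M) \<le> e"
    using eventually_happens[OF bound] by auto
  then have e: "0 \<le> e"
    by (rule order_trans[rotated]) simp
  have "AE x in M. ennreal ((u x - g x)\<^sup>2) = liminf (\<lambda>k. ennreal ((u x - v k x)\<^sup>2))"
    using conv
  proof eventually_elim
    fix x assume "(\<lambda>k. v k x) \<longlonglongrightarrow> g x"
    then have "(\<lambda>k. ennreal ((u x - v k x)\<^sup>2)) \<longlonglongrightarrow> ennreal ((u x - g x)\<^sup>2)"
      by (intro tendsto_ennrealI tendsto_intros)
    then show "ennreal ((u x - g x)\<^sup>2) = liminf (\<lambda>k. ennreal ((u x - v k x)\<^sup>2))"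
      using lim_imp_Liminf[OF sequentially_bot] by metis
  qed
  then have "(\<integral>\<^sup>+x. ennreal ((u x - g x)\<^sup>2) \<partial>M)
      = (\<integral>\<^sup>+x. liminf (\<lambda>k. ennreal ((u x - v k x)\<^sup>2)) \<partial>M)"
    by (rule nn_integral_cong_AE)
  also have "\<dots> \<le> liminf (\<lambda>k. \<integral>\<^sup>+x. ennreal ((u x - v k x)\<^sup>2) \<partial>M)"
    by (rule nn_integral_liminf) simp
  also have "\<dots> \<le> liminf (\<lambda>k. ennreal e)"
    using bound by (intro Liminf_mono)
      (auto elim!: eventually_mono simp: nn_integral_eq_integral int ennreal_leI)
  also have "\<dots> = ennreal e"
    by (simp add: Liminf_const)
  finally have le: "(\<integral>\<^sup>+x. ennreal ((u x - g x)\<^sup>2) \<partial>M) \<le> ennreal e" .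
  show "integrable M (\<lambda>x. (u x - g x)\<^sup>2)"
    using le_less_trans[OF le] by (intro integrableI_nonneg) auto
  then show "(\<integral>x. (u x - g x)\<^sup>2 \<partial>M) \<le> e"
    using le e by (simp add: nn_integral_eq_integral)
qed

theorem Riesz_Fischer:
  fixes f :: "nat \<Rightarrow> 'a \<Rightarrow> real"
  assumes meas [measurable]: "\<And>n. f n \<in> borel_measurable M"
    and int: "\<And>n. integrable M (\<lambda>x. (f n x)\<^sup>2)"
    and Cauchy: "\<And>e. e > 0 \<Longrightarrow> \<exists>N. \<forall>m\<ge>N. \<forall>n\<ge>N. (\<integral>x. (f m x - f n x)\<^sup>2 \<partial>M) \<le> e"
  shows "\<exists>g. g \<in> borel_measurable M \<and> integrable M (\<lambda>x. (g x)\<^sup>2) \<and>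
    (\<lambda>n. \<integral>x. (f n x - g x)\<^sup>2 \<partial>M) \<longlonglongrightarrow> 0"
proof -
  have diff: "integrable M (\<lambda>x. (f m x - f n x)\<^sup>2)" for m n
    by (rule integrable_square_diff[OF meas meas int int])
  have "\<exists>N. \<forall>m\<ge>N. \<forall>n\<ge>N. (\<integral>x. (f m x - f n x)\<^sup>2 \<partial>M) \<le> (1/4)^k" for k :: nat
    by (rule Cauchy) simp
  then obtain N where N: "\<And>k m n. m \<ge> N k \<Longrightarrow> n \<ge> N k \<Longrightarrow> (\<integral>x. (f m x - f n x)\<^sup>2 \<partial>M) \<le> (1/4)^k"
    by metis
  \<comment> \<open>The partial sums dominate each \<open>N k\<close> and increase; the summand \<open>k\<close> makes them unbounded.\<close>
  define r where "r k = k + (\<Sum>j\<le>k. N j)" for k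
  have r_ge: "N k \<le> r k" "k \<le> r k" and r_Suc: "r k \<le> r (Suc k)" for k
    using member_le_sum[of k "{..k}" N] by (auto simp: r_def)
  define g where "g x = lim (\<lambda>k. f (r k) x)" for x
  have [measurable]: "g \<in> borel_measurable M"
    unfolding g_def by measurable
  have "AE x in M. convergent (\<lambda>k. f (r k) x)"
    using r_ge r_Suc by (intro AE_convergent_if_fast_L2_Cauchy diff N) (auto intro: order_trans)
  then have conv: "AE x in M. (\<lambda>k. f (r k) x) \<longlonglongrightarrow> g x"
    by (simp add: g_def convergent_LIMSEQ_iff)
  have close: "\<exists>N. \<forall>n\<ge>N. integrable M (\<lambda>x. (f n x - g x)\<^sup>2) \<and> (\<integral>x. (f n x - g x)\<^sup>2 \<partial>M) \<le> e"
    if e: "e > 0" for e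
  proof -
    obtain K where K: "\<And>m n. m \<ge> K \<Longrightarrow> n \<ge> K \<Longrightarrow> (\<integral>x. (f m x - f n x)\<^sup>2 \<partial>M) \<le> e"
      using Cauchy[OF e] by auto
    have "integrable M (\<lambda>x. (f n x - g x)\<^sup>2) \<and> (\<integral>x. (f n x - g x)\<^sup>2 \<partial>M) \<le> e" if "n \<ge> K" for n
    proof -
      have "eventually (\<lambda>k. (\<integral>x. (f n x - f (r k) x)\<^sup>2 \<partial>M) \<le> e) sequentially"
        using eventually_ge_at_top[of K]
        by eventually_elim (intro K \<open>n \<ge> K\<close> order_trans[OF _ r_ge(2)])
      from L2_dist_limit_le[OF _ _ _ diff conv this] show ?thesis
        by simp
    qed
    then show ?thesis by blast
  qed
  obtain n where n: "integrable M (\<lambda>x. (f n x - g x)\<^sup>2)"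
    using close[of 1] by auto
  have "integrable M (\<lambda>x. (f n x - (f n x - g x))\<^sup>2)"
    by (rule integrable_square_diff[OF _ _ int n]) simp_all
  moreover have "(\<lambda>n. \<integral>x. (f n x - g x)\<^sup>2 \<partial>M) \<longlonglongrightarrow> 0"
  proof (rule LIMSEQ_I)
    fix e :: real assume "e > 0"
    then obtain N where "\<And>n. n \<ge> N \<Longrightarrow> (\<integral>x. (f n x - g x)\<^sup>2 \<partial>M) \<le> e / 2"
      using close[of "e / 2"] by auto
    with \<open>e > 0\<close> show "\<exists>N. \<forall>n\<ge>N. norm ((\<integral>x. (f n x - g x)\<^sup>2 \<partial>M) - 0) < e"
      by (intro exI[of _ N]) (auto intro: le_less_trans[of _ "e / 2"])
  qed
  ultimately show ?thesis
    by (intro exI[of _ g]) simp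
qed

section \<open>The quotient space\<close>

lemma L2_representative:
  obtains f where "square_integrable f" "X = abs_L2 f"
proof -
  have "L2_rel (rep_L2 X) (rep_L2 X)" "abs_L2 (rep_L2 X) = X"
    by (rule Quotient3_rep_reflp[OF Quotient3_L2], rule Quotient3_abs_rep[OF Quotient3_L2])
  then show ?thesis
    by (intro that[of "rep_L2 X"]) (simp_all add: L2_rel_def)
qed

lemma L2_rel_refl: "square_integrable f \<Longrightarrow> L2_rel f f"
  by (simp add: L2_rel_def)

lemma L2_inner_diff_self:
  assumes "square_integrable f" "square_integrable g"
  shows "L2_inner (abs_L2 f - abs_L2 g) (abs_L2 f - abs_L2 g) = (\<integral>x. (f x - g x)\<^sup>2 \<partial>mu)"
  using assms
  by (simp add: minus_L2.abs_eq L2_inner.abs_eq L2_rel_refl square_integrable_diff power2_eq_square)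

text \<open>
  Definiteness is where the passage to classes modulo almost everywhere equality enters: only the
  class of \<open>f\<close> is determined by \<open>\<integral>f\<^sup>2 = 0\<close>.
\<close>

lemma real_inner_product_L2: "real_inner_product L2_inner"
proof
  fix X Y Z :: L2 and c :: real
  obtain f where f: "square_integrable f" "X = abs_L2 f" by (rule L2_representative)
  obtain g where g: "square_integrable g" "Y = abs_L2 g" by (rule L2_representative)
  obtain h where h: "square_integrable h" "Z = abs_L2 h" by (rule L2_representative)
  note [simp] = f g h L2_inner.abs_eq plus_L2.abs_eq scaleR_L2.abs_eq L2_rel_refl
    square_integrable_add square_integrable_scale square_integrable_mult
  show "L2_inner X Y = L2_inner Y X"
    by (simp add: mult.commute)
  show "L2_inner (X + Y) Z = L2_inner X Z + L2_inner Y Z"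
    by (simp add: distrib_right)
  show "L2_inner (c *\<^sub>R X) Y = c * L2_inner X Y"
    by (simp add: mult.assoc)
  show "0 \<le> L2_inner X X"
    by simp
  show "X = 0" if "L2_inner X X = 0"
  proof -
    have "(\<integral>x. f x * f x \<partial>mu) = 0"
      using that by simp
    then have "AE x in mu. f x * f x = 0"
      by (subst (asm) integral_nonneg_eq_0_iff_AE) simp_all
    then have "AE x in mu. f x = 0"
      by simp
    then have "L2_rel f (\<lambda>x. 0)"
      using f(1) by (simp add: L2_rel_def square_integrable_zero)
    then have "abs_L2 f = abs_L2 (\<lambda>x. 0)"
      by (rule Quotient3_rel_abs[OF Quotient3_L2])
    then show ?thesis
      by (simp add: zero_L2_def)
  qed
qed

theorem theorem5p2p5:
  shows "real_hilbert_space L2_inner"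
proof -
  interpret real_inner_product L2_inner
    by (rule real_inner_product_L2)
  show ?thesis
  proof
    fix X :: "nat \<Rightarrow> L2"
    assume X: "ip_Cauchy X"
    have "\<exists>f. square_integrable f \<and> X n = abs_L2 f" for n
      using L2_representative by metis
    then obtain f where f: "\<And>n. square_integrable (f n)" and Xf: "\<And>n. X n = abs_L2 (f n)"
      by metis
    have "\<exists>g. g \<in> borel_measurable mu \<and> integrable mu (\<lambda>x. (g x)\<^sup>2) \<and>
        (\<lambda>n. \<integral>x. (f n x - g x)\<^sup>2 \<partial>mu) \<longlonglongrightarrow> 0"
    proof (rule Riesz_Fischer)
      show "f n \<in> borel_measurable mu" "integrable mu (\<lambda>x. (f n x)\<^sup>2)" for n
        using f by (simp_all add: square_integrable_def)
      fix e :: real assume "e > 0"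
      then obtain N where "\<And>m n. m \<ge> N \<Longrightarrow> n \<ge> N \<Longrightarrow> ip_norm (X m - X n) < sqrt e"
        using X unfolding ip_Cauchy_def by (metis real_sqrt_gt_0_iff)
      then show "\<exists>N. \<forall>m\<ge>N. \<forall>n\<ge>N. (\<integral>x. (f m x - f n x)\<^sup>2 \<partial>mu) \<le> e"
        by (intro exI[of _ N]) (auto simp: ip_norm_def Xf L2_inner_diff_self f less_imp_le)
    qed
    then obtain g where g: "square_integrable g"
      and lim: "(\<lambda>n. \<integral>x. (f n x - g x)\<^sup>2 \<partial>mu) \<longlonglongrightarrow> 0"
      by (auto simp: square_integrable_def)
    have "ip_converges_to X (abs_L2 g)"
      using tendsto_real_sqrt[OF lim]
      by (simp add: ip_converges_to_def ip_norm_def Xf L2_inner_diff_self f g)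
    then show "\<exists>l. ip_converges_to X l" ..
  qed
qed

end
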